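(* Let $p\ge 1$ be an integer, let $a\in\mathbb{D}$, and let $w=h+\overline{g}$ be a sense-preserving harmonic mapping of $\mathbb{D}$ (with $h,g$ analytic in $\mathbb{D}$) such that $\mu(a,w)=p$ and $w(\mathbb{D})\subset\mathbb{D}$. Put $$\Lambda_w^{(p)}(a)=\left|\frac{D^p h(a)}{p!}\right|+\left|\frac{D^p g(a)}{p!}\right|.$$ If $w$ is differentiable at $z=\alpha$ with $w(\alpha)=\beta$, where $\alpha,\beta\in\mathbb{T}$, then $$\mathrm{Re}\Big(\bar\beta\left[w_z(\alpha)\alpha+w_{\bar z}(\alpha)\bar\alpha\right]\Big)\ \ge\ \frac{2}{\pi}\,\frac{(p+1)+\frac{\pi}{4}(p-1)\Lambda_w^{(p)}(a)(1-|a|^2)^p}{1+\frac{\pi}{4}\Lambda_w^{(p)}(a)(1-|a|^2)^p}\cdot\frac{1-|a|^2}{|1-\bar a\alpha|^2}.$$ In particular, when $\alpha=\beta=1$ and $a=0$, this reads $\mathrm{Re}[w_z(1)+w_{\bar z}(1)]\ge\frac{2}{\pi}\frac{(p+1)+\frac{\pi}{4}(p-1)(|a_p|+|b_p|)}{1+\frac{\pi}{4}(|a_p|+|b_p|)}$ with $a_p=\frac{D^ph(0)}{p!}$, $b_p=\frac{D^pg(0)}{p!}$.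
   Context: $\mathbb{D}=\{z\in\mathbb{C}:|z|<1\}$ and $\mathbb{T}=\{z\in\mathbb{C}:|z|=1\}$. $D^k$ denotes the $k$-th order derivative with respect to $z$. A complex-valued $w\in C^2(\mathbb{D})$ is harmonic if $4w_{z\bar z}=0$ in $\mathbb{D}$; then $w=h+\overline{g}$ with $h,g$ analytic in $\mathbb{D}$, unique up to additive constants. Its second complex dilatation is $\omega=\overline{w_{\bar z}}/w_z=g'/h'$. The mapping $w$ is sense-preserving if $h'\not\equiv 0$ and $\omega$ (after removing removable singularities at zeros of $h'$) is analytic in $\mathbb{D}$ with $|\omega(z)|<1$ for all $z\in\mathbb{D}$; zeros of the Jacobian at isolated points are allowed. Multiplicity: let $w=h+\overline g$ be sense-preserving harmonic with $w(z_0)=0$, the additive constants being chosen so that $h(z_0)=g(z_0)=0$. Write $h(z)=\sum_{k\ge n}a_k(z-z_0)^k$ and $g(z)=\sum_{k\ge m}b_k(z-z_0)^k$ near $z_0$ with $a_n\ne0$, $b_m\neq 0$ ($m=\infty$ if $g\equiv0$). Then, since $|\omega(z_0)|<1$, either $n<m$, or $m=n$ and $|b_n|<|a_n|$. One says $w$ has a zero of order $n$ at $z_0$ and writes $\mu(z_0,w)=n$. Differentiability at the boundary point $\alpha\in\mathbb{T}$ with $w(\alpha)=\beta$ means that $w$ is extended to $\mathbb{D}\cup\{\alpha\}$ by $w(\alpha)=\beta$ and there are complex numbers $w_z(\alpha),w_{\bar z}(\alpha)$ with $w(z)=\beta+w_z(\alpha)(z-\alpha)+w_{\bar z}(\alpha)(\bar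 z-\bar\alpha)+o(|z-\alpha|)$ as $z\to\alpha$, $z\in\mathbb{D}$. *)

theory Defs
  imports "HOL-Complex_Analysis.Complex_Analysis"
begin

abbreviation unit_disc :: "complex set" where
  "unit_disc \<equiv> ball 0 1"

abbreviation unit_circle :: "complex set" where
  "unit_circle \<equiv> sphere 0 1"

(* Wirtinger derivatives w_z = (w_x - i w_y) / 2 and w_{\bar z} = (w_x + i w_y) / 2 at interior
   points; the partial derivatives are values of the real Frechet derivative, so these are
   meaningful only where w is real-differentiable. *)

definition wirt_z :: "(complex \<Rightarrow> complex) \<Rightarrow> complex \<Rightarrow> complex" where
  "wirt_z w z = (frechet_derivative w (at z) 1 - \<i> * frechet_derivative w (at z) \<i>) / 2"

definition wirt_zbar :: "(complex \<Rightarrow> complex) \<Rightarrow> complex \<Rightarrow> complex" where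
  "wirt_zbar w z = (frechet_derivative w (at z) 1 + \<i> * frechet_derivative w (at z) \<i>) / 2"

(* C^2 for open S, expressed through Wirtinger derivatives instead of the partial derivatives in
   x and y, of which they are invertible linear combinations. Differentiability is real. *)

definition C2_on :: "(complex \<Rightarrow> complex) \<Rightarrow> complex set \<Rightarrow> bool" where
  "C2_on w S \<longleftrightarrow>
     w differentiable_on S \<and>
     wirt_z w differentiable_on S \<and> wirt_zbar w differentiable_on S \<and>
     continuous_on S (wirt_z (wirt_z w)) \<and> continuous_on S (wirt_zbar (wirt_z w)) \<and>
     continuous_on S (wirt_z (wirt_zbar w)) \<and> continuous_on S (wirt_zbar (wirt_zbar w))"

definition harmonic_on :: "(complex \<Rightarrow> complex) \<Rightarrow> complex set \<Rightarrow> bool" where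
  "harmonic_on w S \<longleftrightarrow> C2_on w S \<and> (\<forall>z\<in>S. 4 * wirt_zbar (wirt_z w) z = 0)"

definition second_dilatation :: "(complex \<Rightarrow> complex) \<Rightarrow> complex \<Rightarrow> complex" where
  "second_dilatation w z = cnj (wirt_zbar w z) / wirt_z w z"

(* For w = h + cnj g one has wirt_z w = h', so the second conjunct says that h' does not vanish
   identically; zeros of h' are allowed, and there remove_sings supplies the limit of the
   dilatation. Without a limit remove_sings yields 0, but holomorphy together with the bound
   |omega| < 1 still excludes poles of the dilatation. *)

definition sense_preserving_harmonic :: "(complex \<Rightarrow> complex) \<Rightarrow> bool" where
  "sense_preserving_harmonic w \<longleftrightarrow>
     harmonic_on w unit_disc \<and>
     (\<exists>z\<in>unit_disc. wirt_z w z \<noteq> 0) \<and>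
     remove_sings (second_dilatation w) holomorphic_on unit_disc \<and>
     (\<forall>z\<in>unit_disc. norm (remove_sings (second_dilatation w) z) < 1)"

abbreviation taylor_coeff :: "(complex \<Rightarrow> complex) \<Rightarrow> complex \<Rightarrow> nat \<Rightarrow> complex" where
  "taylor_coeff f z0 k \<equiv> (deriv ^^ k) f z0 / fact k"

(* mu(z0, w) = n for sense-preserving harmonic w, where h and g are normalised by
   h(z0) = g(z0) = 0 (which implies w(z0) = 0). The order n is that of the analytic part h; the
   co-analytic part g needs no condition, since |omega(z0)| < 1 forces its order m to satisfy
   n < m, or m = n and |b_n| < |a_n|. *)

definition has_zero_of_order :: "(complex \<Rightarrow> complex) \<Rightarrow> complex \<Rightarrow> nat \<Rightarrow> bool" where
  "has_zero_of_order w z0 n \<longleftrightarrow>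
     (\<exists>h g. h holomorphic_on unit_disc \<and> g holomorphic_on unit_disc \<and>
        (\<forall>z\<in>unit_disc. w z = h z + cnj (g z)) \<and>
        h z0 = 0 \<and> g z0 = 0 \<and>
        (\<forall>k<n. taylor_coeff h z0 k = 0) \<and> taylor_coeff h z0 n \<noteq> 0)"

definition Lambda :: "(complex \<Rightarrow> complex) \<Rightarrow> (complex \<Rightarrow> complex) \<Rightarrow> nat \<Rightarrow> complex \<Rightarrow> real" where
  "Lambda h g p a = norm (taylor_coeff h a p) + norm (taylor_coeff g a p)"

(* w is differentiable at the boundary point \<alpha>, approached from within the disc, with
   w_z(\<alpha>) = A and w_{\bar z}(\<alpha>) = B; unfolding has_derivative,
   w z = w \<alpha> + A (z - \<alpha>) + B cnj (z - \<alpha>) + o(|z - \<alpha>|). *)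

definition has_boundary_derivatives ::
    "(complex \<Rightarrow> complex) \<Rightarrow> complex \<Rightarrow> complex \<Rightarrow> complex \<Rightarrow> bool" where
  "has_boundary_derivatives w \<alpha> A B \<longleftrightarrow>
     (w has_derivative (\<lambda>v. A * v + B * cnj v)) (at \<alpha> within unit_disc)"

end

theory Submission
  imports Defs
begin

text \<open>
  A linear functional turns the problem into one about a single holomorphic function. Since
  \<open>cnj \<beta> * cnj (g z)\<close> and \<open>\<beta> * g z\<close> have the same real part, \<open>Re (cnj \<beta> * w z)\<close> is the real part of
  \<open>f = cnj \<beta> * h + \<beta> * g\<close>. So \<open>f\<close> maps the disc into the strip \<open>\<bar>Re s\<bar> < 1\<close>, and once \<open>h\<close> and \<open>g\<close> are
  normalised to vanish at \<open>a\<close>, it has there a zero of order at least \<open>p\<close> with leading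
  coefficient of modulus at most \<open>Lambda h g p a\<close>. For \<open>g\<close> the order comes from \<open>g' = \<omega> h'\<close> with
  \<open>\<omega>\<close> holomorphic (\<open>coanalytic_part_vanishes\<close>).

  Precompose with the disc automorphism that sends \<open>0\<close> to \<open>a\<close>, and postcompose with
  \<open>s \<mapsto> tan (pi / 4 * s)\<close>, the conformal map of the strip onto the disc. The result is
  \<open>\<zeta> ^ p * k \<zeta>\<close> with \<open>\<bar>k\<bar> \<le> 1\<close>, and the Schwarz-Pick inequality for \<open>k\<close> bounds its modulus at
  \<open>\<bar>\<zeta>\<bar> = r\<close> by \<open>\<rho> r = r ^ p * ((r + c) / (1 + c * r))\<close>, where \<open>c = \<bar>k 0\<bar>\<close>. As
  \<open>\<bar>tan (Re s)\<bar> \<le> \<bar>tan s\<bar>\<close> in the strip, the real part of \<open>f\<close> is at most \<open>4 / pi * arctan (\<rho> r)\<close>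
  (\<open>Schwarz_strip_zero\<close> and \<open>Schwarz_strip_Moebius\<close>).

  Along the image of the radius that ends at \<open>\<alpha>\<close>, both sides of this inequality tend to \<open>1\<close>, so the
  slope of the left side at the end point is at least that of the right side, which is
  \<open>2 / pi * (p + (1 - c) / (1 + c))\<close> (\<open>boundary_slope_bound\<close>). The left slope is
  \<open>Re (cnj \<beta> * (wz_\<alpha> * \<alpha> + wzbar_\<alpha> * cnj \<alpha>))\<close> times the modulus of the derivative of the
  automorphism at the boundary (\<open>moebius_radial_path\<close>). The right slope decreases in \<open>c\<close>, so
  \<open>c\<close> may be replaced by its upper bound in terms of \<open>Lambda h g p a\<close>.
\<close>

section \<open>Zeros of holomorphic functions and Taylor coefficients\<close>

text \<open>
  Leibniz's rule for a linear factor, whose derivatives of order two and more vanish. At \<open>z = a\<close>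
  it says that dividing by \<open>z - a\<close> shifts the Taylor coefficients by one place.
\<close>

lemma higher_deriv_linear_factor:
  assumes "q holomorphic_on S" "open S" "z \<in> S"
  shows "(deriv ^^ Suc n) (\<lambda>z. (z - a) * q z) z
           = (z - a) * (deriv ^^ Suc n) q z + of_nat (Suc n) * (deriv ^^ n) q z"
  using assms(3)
proof (induction n arbitrary: z)
  case 0
  have "(q has_field_derivative deriv q z) (at z)"
    using assms(1,2) 0 by (rule holomorphic_derivI)
  then have "((\<lambda>z. (z - a) * q z) has_field_derivative (z - a) * deriv q z + q z) (at z)"
    by (auto intro!: derivative_eq_intros)
  then show ?case
    by (simp add: DERIV_imp_deriv)
next
  case (Suc n)
  let ?rhs = "\<lambda>z. (z - a) * (deriv ^^ Suc n) q z + of_nat (Suc n) * (deriv ^^ n) q z"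
  have holo: "(deriv ^^ k) q holomorphic_on S" for k
    using assms(1,2) by (rule holomorphic_higher_deriv)
  have der: "((deriv ^^ k) q has_field_derivative (deriv ^^ Suc k) q z) (at z)" for k
    using holomorphic_derivI[OF holo assms(2) Suc.prems] by simp
  have "(?rhs has_field_derivative
          (z - a) * (deriv ^^ Suc (Suc n)) q z + of_nat (Suc (Suc n)) * (deriv ^^ Suc n) q z) (at z)"
    by (rule derivative_eq_intros der refl)+ (simp add: algebra_simps)
  then have "deriv ?rhs z
          = (z - a) * (deriv ^^ Suc (Suc n)) q z + of_nat (Suc (Suc n)) * (deriv ^^ Suc n) q z"
    by (rule DERIV_imp_deriv)
  moreover have "deriv ((deriv ^^ Suc n) (\<lambda>z. (z - a) * q z)) z = deriv ?rhs z"
  proof (rule complex_derivative_transform_within_open[OF _ _ assms(2) Suc.prems])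
    show "(deriv ^^ Suc n) (\<lambda>z. (z - a) * q z) holomorphic_on S"
      by (intro holomorphic_higher_deriv holomorphic_intros assms)
    show "?rhs holomorphic_on S"
      by (intro holomorphic_intros holo)
  qed (rule Suc.IH)
  ultimately show ?case
    by simp
qed

text \<open>
  Induction on \<open>n\<close>, splitting off one factor \<open>z - a\<close> at a time. The quotient is holomorphic on
  all of \<open>S\<close> because its singularity at \<open>a\<close> is removable. The order of the zero may exceed \<open>n\<close>, and
  \<open>f\<close> may vanish identically; the coanalytic part of a harmonic mapping can do either.
\<close>

lemma higher_deriv_zero_factor:
  assumes "f holomorphic_on S" "open S" "a \<in> S"
    and "\<And>k. k < n \<Longrightarrow> (deriv ^^ k) f a = 0"
  obtains q where "q holomorphic_on S" "\<And>z. z \<in> S \<Longrightarrow> f z = (z - a) ^ n * q z"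
    "q a = taylor_coeff f a n"
  using assms(1,4)
proof (induction n arbitrary: f thesis)
  case 0
  show ?case
    by (rule "0.prems"(1)[of f]) (use 0 in auto)
next
  case (Suc n)
  define f1 where "f1 = (\<lambda>z. if z = a then deriv f a else (f z - f a) / (z - a))"
  have f1: "f1 holomorphic_on S"
    unfolding f1_def by (rule pole_lemma_open) (use Suc assms in auto)
  have "f a = 0"
    using Suc.prems(3)[of 0] by simp
  then have f: "f z = (z - a) * f1 z" for z
    by (simp add: f1_def)
  then have "f = (\<lambda>z. (z - a) * f1 z)"
    by blast
  then have d: "(deriv ^^ Suc k) f a = of_nat (Suc k) * (deriv ^^ k) f1 a" for k
    using higher_deriv_linear_factor[OF f1 assms(2,3), where a = a] by simp
  have "(deriv ^^ k) f1 a = 0" if "k < n" for k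
    using d[of k] Suc.prems(3)[of "Suc k"] that by (simp del: of_nat_Suc funpow.simps)
  then obtain q where q: "q holomorphic_on S" "\<And>z. z \<in> S \<Longrightarrow> f1 z = (z - a) ^ n * q z"
    "q a = taylor_coeff f1 a n"
    using Suc.IH f1 by blast
  show ?case
  proof (rule Suc.prems(1)[OF q(1)])
    show "f z = (z - a) ^ Suc n * q z" if "z \<in> S" for z
      using f q(2) that by simp
    show "q a = taylor_coeff f a (Suc n)"
      using q(3) d[of n] by (simp del: of_nat_Suc funpow.simps)
  qed
qed

lemma higher_deriv_eq_0_of_factor:
  assumes "q holomorphic_on S" "open S" "a \<in> S" "k < n"
  shows "(deriv ^^ k) (\<lambda>z. (z - a) ^ n * q z) a = 0"
  using assms(1,4)
proof (induction n arbitrary: k)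
  case (Suc n)
  let ?f1 = "\<lambda>z. (z - a) ^ n * q z"
  have eq: "(\<lambda>z. (z - a) ^ Suc n * q z) = (\<lambda>z. (z - a) * ?f1 z)"
    by (simp add: mult.assoc)
  have f1: "?f1 holomorphic_on S"
    using Suc.prems by (intro holomorphic_intros)
  show ?case
  proof (cases k)
    case (Suc j)
    then show ?thesis
      using Suc.IH Suc.prems higher_deriv_linear_factor[OF f1 assms(2,3), of j a]
      unfolding eq by (simp del: funpow.simps)
  qed simp
qed simp

section \<open>Wirtinger derivatives and the dilatation\<close>

text \<open>
  Hence \<open>h'\<close> and \<open>g'\<close> depend on \<open>w\<close> only: two decompositions of \<open>w\<close> have the same Taylor
  coefficients of positive order.
\<close>

lemma wirtinger_of_decomposition:
  assumes "h holomorphic_on S" "g holomorphic_on S" "open S" "z \<in> S"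
    and "\<And>z. z \<in> S \<Longrightarrow> w z = h z + cnj (g z)"
  shows "wirt_z w z = deriv h z" "wirt_zbar w z = cnj (deriv g z)"
proof -
  have h: "(h has_derivative (\<lambda>v. deriv h z * v)) (at z)"
    using holomorphic_derivI[OF assms(1,3,4)] by (simp add: has_field_derivative_def)
  have g: "(g has_derivative (\<lambda>v. deriv g z * v)) (at z)"
    using holomorphic_derivI[OF assms(2,3,4)] by (simp add: has_field_derivative_def)
  have "((\<lambda>z. h z + cnj (g z)) has_derivative
          (\<lambda>v. deriv h z * v + cnj (deriv g z * v))) (at z)"
    by (intro has_derivative_add h has_derivative_cnj g)
  then have "(w has_derivative (\<lambda>v. deriv h z * v + cnj (deriv g z * v))) (at z)"
    by (rule has_derivative_transform_within_open[OF _ assms(3,4)]) (simp add: assms)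
  then have D: "frechet_derivative w (at z) = (\<lambda>v. deriv h z * v + cnj (deriv g z * v))"
    by (metis frechet_derivative_at)
  show "wirt_z w z = deriv h z" "wirt_zbar w z = cnj (deriv g z)"
    unfolding wirt_z_def wirt_zbar_def D by (simp_all add: algebra_simps)
qed

lemma continuous_eq_at_puncture:
  fixes f g :: "complex \<Rightarrow> complex"
  assumes "isCont f a" "isCont g a" "eventually (\<lambda>z. f z = g z) (at a)"
  shows "f a = g a"
proof -
  have "(f \<longlongrightarrow> g a) (at a)"
    using assms(2,3) tendsto_cong unfolding isCont_def by (metis (mono_tags, lifting))
  then show ?thesis
    using assms(1) unfolding isCont_def by (metis LIM_unique)
qed

text \<open>
  Because \<open>g' = \<omega> h'\<close> and \<open>\<omega>\<close> is holomorphic at \<open>a\<close>, the order of \<open>g'\<close> at \<open>a\<close> is at least the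
  order \<open>p - 1\<close> of \<open>h'\<close>. The dilatation is a quotient and equals \<open>\<omega>\<close> a priori only where \<open>h'\<close> does not
  vanish; near \<open>a\<close> this is a punctured neighbourhood since \<open>h'\<close> has a zero of finite order, and
  continuity extends the identity to \<open>a\<close>.
\<close>

lemma coanalytic_part_vanishes:
  assumes h: "h holomorphic_on unit_disc" and g: "g holomorphic_on unit_disc"
    and w: "\<And>z. z \<in> unit_disc \<Longrightarrow> w z = h z + cnj (g z)"
    and \<omega>: "remove_sings (second_dilatation w) holomorphic_on unit_disc"
    and a: "a \<in> unit_disc" and "g a = 0"
    and van: "\<And>k. k < p \<Longrightarrow> (deriv ^^ k) h a = 0" and nz: "(deriv ^^ p) h a \<noteq> 0"
    and "k < p"
  shows "(deriv ^^ k) g a = 0"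
proof (cases k)
  case 0
  then show ?thesis using assms by simp
next
  case (Suc j)
  define om where "om = remove_sings (second_dilatation w)"
  obtain m where m: "p = Suc m"
    using \<open>k < p\<close> by (cases p) auto
  have dh: "deriv h holomorphic_on unit_disc" and dg: "deriv g holomorphic_on unit_disc"
    using h g by (auto intro: holomorphic_deriv)
  have "(deriv ^^ i) (deriv h) a = 0" if "i < m" for i
    using van[of "Suc i"] that m by (simp add: funpow_swap1)
  then obtain q where q: "q holomorphic_on unit_disc"
      "\<And>z. z \<in> unit_disc \<Longrightarrow> deriv h z = (z - a) ^ m * q z"
      "q a = taylor_coeff (deriv h) a m"
    using higher_deriv_zero_factor[OF dh _ a] by (metis open_ball)
  have "q a \<noteq> 0"
    using nz m q(3) by (simp add: funpow_swap1)
  moreover have "isCont q a"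
    using q(1) a continuous_on_eq_continuous_at holomorphic_on_imp_continuous_on open_ball by blast
  ultimately have "eventually (\<lambda>z. q z \<noteq> 0) (at a)"
    by (simp add: isCont_def tendsto_imp_eventually_ne)
  \<comment> \<open>Where \<open>h'\<close> does not vanish the dilatation is analytic, so that removing singularities
     leaves it unchanged.\<close>
  have punct: "deriv g z = om z * deriv h z" if "z \<in> unit_disc" "deriv h z \<noteq> 0" for z
  proof -
    let ?U = "{z \<in> unit_disc. deriv h z \<noteq> 0}"
    have U: "open ?U"
      using continuous_open_preimage[OF holomorphic_on_imp_continuous_on[OF dh] open_ball
          open_Compl[OF closed_singleton[of 0]]]
      by (simp add: vimage_def Int_def)
    have eq: "second_dilatation w x = deriv g x / deriv h x" if "x \<in> ?U" for x
      using that wirtinger_of_decomposition[OF h g open_ball _ w, of x]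
      by (simp add: second_dilatation_def)
    have "(\<lambda>x. deriv g x / deriv h x) holomorphic_on ?U"
      by (rule holomorphic_on_divide[OF holomorphic_on_subset[OF dg] holomorphic_on_subset[OF dh]])
        auto
    then have "second_dilatation w holomorphic_on ?U"
      by (rule holomorphic_transform) (simp only: eq)
    then have "second_dilatation w analytic_on {z}"
      unfolding analytic_at using U that by (intro exI[of _ ?U]) simp
    then have "om z = deriv g z / deriv h z"
      using eq that by (simp add: om_def)
    then show ?thesis
      using that by simp
  qed
  have ev: "eventually (\<lambda>z. deriv g z = om z * deriv h z) (at a)"
  proof -
    have "eventually (\<lambda>z. z \<in> unit_disc) (at a)" "eventually (\<lambda>z. z \<noteq> a) (at a)"
      using a eventually_at_in_open'[of unit_disc a] by (auto simp: eventually_at_filter)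
    with \<open>eventually (\<lambda>z. q z \<noteq> 0) (at a)\<close> show ?thesis
      by eventually_elim (use punct q(2) in auto)
  qed
  have cont: "isCont f a" if "f holomorphic_on unit_disc" for f
    using that a continuous_on_eq_continuous_at holomorphic_on_imp_continuous_on open_ball by blast
  have "deriv g a = om a * deriv h a"
    by (rule continuous_eq_at_puncture[OF _ _ ev])
      (intro cont holomorphic_intros dg dh \<omega>[folded om_def])+
  with ev have "eventually (\<lambda>z. deriv g z = om z * deriv h z) (nhds a)"
    by (simp add: eventually_nhds_conv_at)
  moreover have "eventually (\<lambda>z. z \<in> unit_disc) (nhds a)"
    using a by (intro eventually_nhds_in_open open_ball)
  ultimately have "eventually (\<lambda>z. deriv g z = (z - a) ^ m * (om z * q z)) (nhds a)"
    by eventually_elim (simp add: q(2))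
  then have "(deriv ^^ j) (deriv g) a = (deriv ^^ j) (\<lambda>z. (z - a) ^ m * (om z * q z)) a"
    by (rule higher_deriv_cong_ev) simp
  also have "\<dots> = 0"
    by (rule higher_deriv_eq_0_of_factor[where S = unit_disc])
      (use Suc m \<open>k < p\<close> a q(1) \<omega> in \<open>auto simp: om_def intro!: holomorphic_intros\<close>)
  finally show ?thesis
    by (simp add: Suc funpow_swap1)
qed

text \<open>
  Normalises the additive constants of a given decomposition of \<open>w\<close>: both parts then vanish at
  \<open>a\<close> to order \<open>p\<close>, while the coefficients that enter \<open>Lambda\<close> stay the same, since \<open>p\<close> is positive.
\<close>

lemma vanishing_decomposition:
  assumes "p \<ge> 1" and a: "a \<in> unit_disc"
    and h: "h holomorphic_on unit_disc" and g: "g holomorphic_on unit_disc"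
    and w: "\<forall>z\<in>unit_disc. w z = h z + cnj (g z)"
    and sp: "sense_preserving_harmonic w" and zero: "has_zero_of_order w a p"
  obtains h0 g0 where "h0 holomorphic_on unit_disc" "g0 holomorphic_on unit_disc"
    "\<And>z. z \<in> unit_disc \<Longrightarrow> w z = h0 z + cnj (g0 z)"
    "\<And>k. k < p \<Longrightarrow> (deriv ^^ k) h0 a = 0" "\<And>k. k < p \<Longrightarrow> (deriv ^^ k) g0 a = 0"
    "(deriv ^^ p) h0 a = (deriv ^^ p) h a" "(deriv ^^ p) g0 a = (deriv ^^ p) g a"
proof -
  obtain h0 g0 where h0: "h0 holomorphic_on unit_disc" and g0: "g0 holomorphic_on unit_disc"
    and w0: "\<And>z. z \<in> unit_disc \<Longrightarrow> w z = h0 z + cnj (g0 z)" and "g0 a = 0"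
    and van: "\<And>k. k < p \<Longrightarrow> (deriv ^^ k) h0 a = 0" and "(deriv ^^ p) h0 a \<noteq> 0"
    using zero unfolding has_zero_of_order_def by auto
  have w': "\<And>z. z \<in> unit_disc \<Longrightarrow> w z = h z + cnj (g z)"
    using w by blast
  have dh: "deriv h0 z = deriv h z" and dg: "deriv g0 z = deriv g z" if "z \<in> unit_disc" for z
    using wirtinger_of_decomposition[OF h g open_ball that w']
      wirtinger_of_decomposition[OF h0 g0 open_ball that w0] by auto
  obtain m where m: "p = Suc m"
    using \<open>p \<ge> 1\<close> by (cases p) auto
  have eq: "(deriv ^^ p) u a = (deriv ^^ p) v a"
    if "u holomorphic_on unit_disc" "v holomorphic_on unit_disc"
      "\<And>z. z \<in> unit_disc \<Longrightarrow> deriv u z = deriv v z" for u v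
  proof -
    have "(deriv ^^ m) (deriv u) a = (deriv ^^ m) (deriv v) a"
      by (rule higher_deriv_transform_within_open[OF _ _ open_ball a that(3)])
        (auto intro: holomorphic_deriv that)
    then show ?thesis
      by (simp only: m funpow_Suc_right o_def)
  qed
  show ?thesis
  proof (rule that[OF h0 g0 w0 van])
    show "(deriv ^^ k) g0 a = 0" if "k < p" for k
      by (rule coanalytic_part_vanishes[OF h0 g0 w0 _ a \<open>g0 a = 0\<close> van _ that])
        (use sp \<open>(deriv ^^ p) h0 a \<noteq> 0\<close> in \<open>auto simp: sense_preserving_harmonic_def\<close>)
    show "(deriv ^^ p) h0 a = (deriv ^^ p) h a"
      by (rule eq[OF h0 h dh])
    show "(deriv ^^ p) g0 a = (deriv ^^ p) g a"
      by (rule eq[OF g0 g dg])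
  qed
qed

section \<open>A Schwarz lemma for maps into a strip\<close>

text \<open>
  Write \<open>s = x + \<i> y\<close> and \<open>e = (sinh y)\<^sup>2\<close>. Then \<open>\<bar>tan s\<bar>\<^sup>2 = ((sin x)\<^sup>2 + e) / ((cos x)\<^sup>2 + e)\<close>, and
  \<open>(sin x)\<^sup>2 < (cos x)\<^sup>2\<close> in the strip. So the quotient is below \<open>1\<close>, and adding \<open>e\<close> to numerator and
  denominator moves it upwards from its value \<open>(tan x)\<^sup>2\<close> at \<open>y = 0\<close>.
\<close>

lemma tan_strip:
  fixes s :: complex
  assumes "\<bar>Re s\<bar> < pi / 4"
  shows "cos s \<noteq> 0" "\<bar>tan (Re s)\<bar> \<le> norm (tan s)" "norm (tan s) < 1"
proof -
  define x where "x = Re s"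
  define e where "e = (exp (Im s) - inverse (exp (Im s)))\<^sup>2 / 4"
  have e: "e \<ge> 0"
    by (simp add: e_def)
  have c: "(norm (cos s))\<^sup>2 = (cos x)\<^sup>2 + e"
    by (simp add: norm_cos_squared e_def x_def)
  have s: "(norm (sin s))\<^sup>2 = (sin x)\<^sup>2 + e"
    unfolding norm_sin_squared x_def e_def exp_double cos_double_sin
    by (simp add: field_simps power2_eq_square)
  have "cos x > 0"
    using assms by (intro cos_gt_zero_pi) (auto simp: x_def)
  have "cos (2 * x) > 0"
    using assms by (intro cos_gt_zero_pi) (auto simp: x_def)
  then have sc: "(sin x)\<^sup>2 < (cos x)\<^sup>2"
    by (simp add: cos_double)
  have cpos: "(norm (cos s))\<^sup>2 > 0"
    using \<open>cos x > 0\<close> c e by (simp add: add_pos_nonneg)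
  then show "cos s \<noteq> 0"
    by auto
  have t: "(norm (tan s))\<^sup>2 = ((sin x)\<^sup>2 + e) / ((cos x)\<^sup>2 + e)"
    by (simp add: tan_def norm_divide power_divide c s)
  have "(norm (tan s))\<^sup>2 < 1"
    using cpos c sc by (simp add: t)
  then show "norm (tan s) < 1"
    by (metis abs_norm_cancel abs_square_less_1)
  have "(tan x)\<^sup>2 = (sin x)\<^sup>2 / (cos x)\<^sup>2"
    by (simp add: tan_def power_divide)
  also have "\<dots> \<le> ((sin x)\<^sup>2 + e) / ((cos x)\<^sup>2 + e)"
  proof -
    have "(sin x)\<^sup>2 * e \<le> (cos x)\<^sup>2 * e"
      using sc e by (intro mult_right_mono) auto
    then show ?thesis
      using \<open>cos x > 0\<close> e by (simp add: divide_simps add_pos_nonneg) (simp add: algebra_simps)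
  qed
  finally have "(tan x)\<^sup>2 \<le> (norm (tan s))\<^sup>2"
    by (simp add: t)
  then show "\<bar>tan (Re s)\<bar> \<le> norm (tan s)"
    using abs_le_square_iff[of "tan x" "norm (tan s)"] by (simp add: x_def)
qed

text \<open>
  The Schwarz lemma, applied to \<open>k\<close> followed by the disc automorphism that sends \<open>c = k 0\<close> to \<open>0\<close>, gives
  \<open>\<bar>k z - c\<bar> \<le> \<bar>z\<bar> * \<bar>1 - cnj c * k z\<bar>\<close>; the rest is algebra with the moduli. If \<open>k\<close> reaches
  the unit circle, the maximum principle makes it constant, and the bound is \<open>1\<close>.
\<close>

lemma Schwarz_Pick_zero:
  assumes hol: "k holomorphic_on unit_disc"
    and le1: "\<And>z. z \<in> unit_disc \<Longrightarrow> norm (k z) \<le> 1" and z: "z \<in> unit_disc"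
  shows "norm (k z) \<le> (norm z + norm (k 0)) / (1 + norm (k 0) * norm z)"
proof (cases "\<exists>z\<in>unit_disc. norm (k z) = 1")
  case True
  then obtain z1 where z1: "z1 \<in> unit_disc" "norm (k z1) = 1"
    by blast
  have "k constant_on unit_disc"
    by (rule maximum_modulus_principle[OF hol _ _ _ _ z1(1)]) (use z1 le1 in auto)
  then have "norm (k 0) = 1"
    using z1 by (metis constant_on_def centre_in_ball zero_less_one)
  then show ?thesis
    using le1[OF z] by (simp add: add.commute add_nonneg_eq_0_iff)
next
  case False
  define c where "c = k 0"
  have lt1: "norm (k z) < 1" if "z \<in> unit_disc" for z
    using False le1[OF that] that by fastforce
  then have c: "norm c < 1"
    by (simp add: c_def)
  have "norm (Moebius_function 0 c (k z)) \<le> norm z"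
  proof (rule Schwarz_Lemma(1)[of "Moebius_function 0 c \<circ> k"
          , unfolded comp_def])
    show "(\<lambda>x. Moebius_function 0 c (k x)) holomorphic_on unit_disc"
      using holomorphic_on_compose_gen[OF hol Moebius_function_holomorphic[OF c, of 0]] lt1
      by (auto simp: o_def image_subset_iff)
    show "Moebius_function 0 c (k 0) = 0"
      by (simp add: c_def Moebius_function_eq_zero)
  qed (use z c lt1 Moebius_function_norm_lt_1 in auto)
  define s t r where "s = norm (k z)" and "t = norm c" and "r = norm z"
  have st: "0 \<le> s" "s < 1" "0 \<le> t" "t < 1" "0 \<le> r" "r < 1"
    using lt1[OF z] c z by (auto simp: s_def t_def r_def)
  have "s * t < 1"
    using mult_left_le[of t s] st by linarith
  have "1 - cnj c * k z \<noteq> 0"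
  proof
    assume "1 - cnj c * k z = 0"
    then have "norm (cnj c * k z) = 1"
      by (metis eq_iff_diff_eq_0 norm_one)
    then have "t * s = 1"
      by (simp add: norm_mult s_def t_def)
    then show False
      using \<open>s * t < 1\<close> by (simp add: mult.commute)
  qed
  then have le: "norm (k z - c) \<le> r * norm (1 - cnj c * k z)"
    using \<open>norm (Moebius_function 0 c (k z)) \<le> norm z\<close>
    by (simp add: Moebius_function_simple norm_divide r_def divide_simps)
  define N where "N = (norm (1 - cnj c * k z))\<^sup>2"
  have id: "(norm (k z - c))\<^sup>2 = N - (1 - s\<^sup>2) * (1 - t\<^sup>2)"
    unfolding N_def s_def t_def cmod_power2 by (simp add: algebra_simps power2_eq_square)
  have "norm (1 - cnj c * k z) \<ge> 1 - s * t"
    using norm_triangle_ineq2[of 1 "cnj c * k z"] by (simp add: norm_mult s_def t_def mult.commute)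
  then have "N \<ge> (1 - s * t)\<^sup>2"
    using \<open>s * t < 1\<close> by (simp add: N_def power_mono)
  \<comment> \<open>The identity turns the Schwarz bound into a lower bound for \<open>(1 - s\<^sup>2) * (1 - t\<^sup>2)\<close>;
    the triangle inequality then replaces \<open>N\<close> by an expression in the moduli alone.\<close>
  have "N * (1 - r\<^sup>2) \<le> (1 - s\<^sup>2) * (1 - t\<^sup>2)"
    using power_mono[OF le, of 2] unfolding id by (simp add: power_mult_distrib N_def algebra_simps)
  moreover have "(1 - s * t)\<^sup>2 * (1 - r\<^sup>2) \<le> N * (1 - r\<^sup>2)"
    using \<open>N \<ge> (1 - s * t)\<^sup>2\<close> st by (intro mult_right_mono) (auto simp: power_le_one)
  ultimately have "(1 - s * t)\<^sup>2 * (1 - r\<^sup>2) \<le> (1 - s\<^sup>2) * (1 - t\<^sup>2)"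
    by linarith
  then have "(s - t)\<^sup>2 \<le> (r * (1 - s * t))\<^sup>2"
    by (simp add: power2_eq_square algebra_simps)
  then have "s - t \<le> r * (1 - s * t)"
    using st \<open>s * t < 1\<close> by (intro power2_le_imp_le[of "s - t"]) auto
  then have "s * (1 + t * r) \<le> r + t"
    by (simp add: algebra_simps)
  then show ?thesis
    using st unfolding c_def[symmetric] s_def[symmetric] t_def[symmetric] r_def[symmetric]
    by (simp add: pos_le_divide_eq add_pos_nonneg)
qed

text \<open>
  The maximum principle on the circle of radius \<open>r\<close> gives \<open>\<bar>q z\<bar> \<le> 1 / r ^ n\<close>; let \<open>r\<close> tend to \<open>1\<close>.
  It replaces \<open>n\<close> successive applications of the Schwarz lemma.
\<close>

lemma bounded_by_1_after_dividing_zero: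
  assumes q: "q holomorphic_on unit_disc"
    and le: "\<And>z. z \<in> unit_disc \<Longrightarrow> norm (z ^ n * q z) \<le> 1" and z: "z \<in> unit_disc"
  shows "norm (q z) \<le> 1"
proof -
  have bound: "norm (q z) * r ^ n \<le> 1" if r: "norm z < r" "r < 1" for r
  proof -
    have "r > 0"
      using r norm_ge_zero[of z] by linarith
    have "norm (q z) \<le> inverse (r ^ n)"
    proof (rule maximum_modulus_frontier[of q "ball 0 r"])
      show "q holomorphic_on interior (ball 0 r)"
        using r by (auto intro: holomorphic_on_subset[OF q])
      show "continuous_on (closure (ball 0 r)) q"
        using \<open>r > 0\<close> r
        by (auto intro!: holomorphic_on_imp_continuous_on holomorphic_on_subset[OF q])
      show "norm (q u) \<le> inverse (r ^ n)" if "u \<in> frontier (ball 0 r)" for u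
        using le[of u] that r \<open>r > 0\<close> by (simp add: norm_mult norm_power field_simps)
    qed (use r in auto)
    then show ?thesis
      using \<open>r > 0\<close> by (simp add: field_simps)
  qed
  have "((\<lambda>r. norm (q z) * r ^ n) \<longlongrightarrow> norm (q z) * 1 ^ n) (at_left 1)"
    by (intro tendsto_intros)
  moreover have "eventually (\<lambda>r. norm (q z) * r ^ n \<le> 1) (at_left 1)"
    using eventually_at_left_real[of "norm z" 1] z by (auto elim!: eventually_mono intro: bound)
  ultimately have "norm (q z) * 1 ^ n \<le> 1"
    by (intro tendsto_upperbound) auto
  then show ?thesis
    by simp
qed

text \<open>
  Through this factor, the factorisation \<open>z ^ n * q z\<close> of a map into the strip passes to its
  composition with the tangent, and the new leading coefficient can be read off at once.
\<close>

lemma tan_factor: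
  obtains \<tau> where "\<tau> holomorphic_on {s. \<bar>Re s\<bar> < pi / 4}" "\<tau> 0 = 1" "\<And>s::complex. tan s = s * \<tau> s"
proof -
  define \<tau> where "\<tau> = (\<lambda>s::complex. if s = 0 then deriv tan 0 else (tan s - tan 0) / (s - 0))"
  have S: "open {s. \<bar>Re s\<bar> < pi / 4}"
    by (intro open_Collect_less continuous_intros)
  have "tan holomorphic_on {s::complex. \<bar>Re s\<bar> < pi / 4}"
    by (rule holomorphic_on_tan) (use tan_strip(1) in blast)
  then have "\<tau> holomorphic_on {s. \<bar>Re s\<bar> < pi / 4}"
    unfolding \<tau>_def using S by (rule pole_lemma_open)
  moreover have "(tan has_field_derivative 1) (at (0::complex))"
    using DERIV_tan[of "0::complex"] by simp
  then have "\<tau> 0 = 1"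
    by (simp add: \<tau>_def DERIV_imp_deriv)
  moreover have "tan s = s * \<tau> s" for s
    by (simp add: \<tau>_def)
  ultimately show ?thesis
    using that by blast
qed

text \<open>
  Composing with \<open>s \<mapsto> tan (pi / 4 * s)\<close> gives a map \<open>z ^ n * k z\<close> of the disc into itself. Since the
  tangent has derivative \<open>1\<close> at \<open>0\<close>, \<open>\<bar>k 0\<bar> = pi / 4 * \<bar>q 0\<bar>\<close>, and Schwarz-Pick bounds \<open>k\<close>.
\<close>

lemma Schwarz_strip_zero:
  assumes "n \<ge> 1" and q: "q holomorphic_on unit_disc"
    and strip: "\<And>z. z \<in> unit_disc \<Longrightarrow> \<bar>Re (z ^ n * q z)\<bar> < 1"
    and z: "z \<in> unit_disc"
  shows "\<bar>Re (z ^ n * q z)\<bar>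
    \<le> 4 / pi * arctan (norm z ^ n * ((norm z + pi / 4 * norm (q 0)) / (1 + pi / 4 * norm (q 0) * norm z)))"
    (is "_ \<le> 4 / pi * arctan ?R")
proof -
  obtain \<tau> where \<tau>: "\<tau> holomorphic_on {s. \<bar>Re s\<bar> < pi / 4}" "\<tau> 0 = 1"
    "\<And>s::complex. tan s = s * \<tau> s"
    by (rule tan_factor) (rule that)
  define f where "f = (\<lambda>z. of_real (pi / 4) * (z ^ n * q z))"
  define k where "k = (\<lambda>z. of_real (pi / 4) * q z * \<tau> (f z))"
  have Ref: "\<bar>Re (f z)\<bar> = pi / 4 * \<bar>Re (z ^ n * q z)\<bar>" for z
  proof -
    have "Re (of_real (pi / 4) * x) = pi / 4 * Re x" for x
      by simp
    then show ?thesis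
      unfolding f_def by (simp only: abs_mult) simp
  qed
  have f: "\<bar>Re (f z)\<bar> < pi / 4" if "z \<in> unit_disc" for z
    using strip[OF that] by (simp add: Ref)
  have "f holomorphic_on unit_disc"
    unfolding f_def by (intro holomorphic_intros q)
  then have "(\<lambda>z. \<tau> (f z)) holomorphic_on unit_disc"
    using holomorphic_on_compose_gen[OF _ \<tau>(1), of f unit_disc] f
    by (simp only: o_def image_subset_iff mem_Collect_eq) blast
  then have hk: "k holomorphic_on unit_disc"
    unfolding k_def by (intro holomorphic_intros q)
  have tan: "tan (f z) = z ^ n * k z" for z
    by (simp add: \<tau>(3)[of "f z"] k_def) (simp add: f_def)
  have k1: "norm (k z) \<le> 1" if "z \<in> unit_disc" for z
  proof (rule bounded_by_1_after_dividing_zero[OF hk _ that, of n])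
    show "norm (u ^ n * k u) \<le> 1" if "u \<in> unit_disc" for u
      using tan_strip(3)[OF f[OF that]] by (simp only: tan)
  qed
  have "norm (k 0) = pi / 4 * norm (q 0)"
  proof -
    have "f 0 = 0"
      using \<open>n \<ge> 1\<close> by (simp add: f_def)
    then show ?thesis
      by (simp add: k_def \<tau> norm_mult)
  qed
  then have "norm (k z) \<le> (norm z + pi / 4 * norm (q 0)) / (1 + pi / 4 * norm (q 0) * norm z)"
    using Schwarz_Pick_zero[OF hk k1 z] by (simp only:)
  then have "norm (tan (f z)) \<le> ?R"
    by (simp add: tan norm_mult norm_power mult_left_mono del: times_divide_eq_right)
  moreover have "tan \<bar>Re (f z)\<bar> \<le> norm (tan (f z))"
    using tan_strip(2)[OF f[OF z]] by (auto simp: abs_if split: if_splits)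
  ultimately have "tan \<bar>Re (f z)\<bar> \<le> ?R"
    by linarith
  then have "arctan (tan \<bar>Re (f z)\<bar>) \<le> arctan ?R"
    by (simp only: arctan_le_iff)
  moreover have "arctan (tan \<bar>Re (f z)\<bar>) = \<bar>Re (f z)\<bar>"
    using f[OF z] by (intro arctan_tan) auto
  ultimately show ?thesis
    unfolding Ref by (simp add: field_simps)
qed

text \<open>
  The zero is moved from \<open>0\<close> to \<open>a\<close> by the disc automorphism \<open>M\<close> with \<open>M 0 = a\<close>. The power of
  \<open>1 - \<bar>a\<bar>\<^sup>2\<close> in \<open>c\<close> stems from \<open>M \<zeta> - a = \<zeta> * b \<zeta>\<close> with \<open>b 0 = 1 - \<bar>a\<bar>\<^sup>2\<close>.
\<close>

lemma Schwarz_strip_Moebius: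
  assumes "p \<ge> 1" and a: "a \<in> unit_disc" and q: "q holomorphic_on unit_disc"
    and f: "\<And>z. z \<in> unit_disc \<Longrightarrow> f z = (z - a) ^ p * q z"
    and strip: "\<And>z. z \<in> unit_disc \<Longrightarrow> \<bar>Re (f z)\<bar> < 1" and \<zeta>: "\<zeta> \<in> unit_disc"
  defines "c \<equiv> pi / 4 * (norm (q a) * (1 - (norm a)\<^sup>2) ^ p)"
  shows "Re (f (Moebius_function 0 (-a) \<zeta>))
           \<le> 4 / pi * arctan (norm \<zeta> ^ p * ((norm \<zeta> + c) / (1 + c * norm \<zeta>)))"
proof -
  define M where "M = Moebius_function 0 (-a)"
  define b where "b = (\<lambda>\<zeta>. (1 - a * cnj a) / (1 + cnj a * \<zeta>))"
  define Q where "Q = (\<lambda>\<zeta>. b \<zeta> ^ p * q (M \<zeta>))"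
  have M: "M \<zeta> \<in> unit_disc" if "\<zeta> \<in> unit_disc" for \<zeta>
    using Moebius_function_norm_lt_1[of "-a" \<zeta>] that a by (simp add: M_def)
  have den: "1 + cnj a * \<zeta> \<noteq> 0" if "\<zeta> \<in> unit_disc" for \<zeta>
  proof
    assume "1 + cnj a * \<zeta> = 0"
    then have "norm (cnj a * \<zeta>) = 1"
      by (metis add_eq_0_iff norm_minus_cancel norm_one)
    moreover have "norm (cnj a) * norm \<zeta> \<le> norm (cnj a)"
      using that by (intro mult_left_le) auto
    ultimately show False
      using a by (simp add: norm_mult)
  qed
  have "b holomorphic_on unit_disc"
    unfolding b_def using den by (intro holomorphic_intros) auto
  moreover have "(\<lambda>\<zeta>. q (M \<zeta>)) holomorphic_on unit_disc"
    using holomorphic_on_compose_gen[OF _ q, of M unit_disc] M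
      Moebius_function_holomorphic[of "-a" 0] a
    by (simp add: o_def image_subset_iff M_def)
  ultimately have Q: "Q holomorphic_on unit_disc"
    unfolding Q_def by (intro holomorphic_intros)
  have fM: "\<zeta> ^ p * Q \<zeta> = f (M \<zeta>)" if "\<zeta> \<in> unit_disc" for \<zeta>
  proof -
    have "M \<zeta> - a = \<zeta> * b \<zeta>"
      using den[OF that] by (simp add: M_def b_def Moebius_function_simple divide_simps)
        (simp add: algebra_simps)
    then show ?thesis
      using f[OF M[OF that]] by (simp add: Q_def power_mult_distrib)
  qed
  have "(norm a)\<^sup>2 < 1"
    using a by (simp add: abs_square_less_1)
  moreover have "1 - a * cnj a = of_real (1 - (norm a)\<^sup>2)"
    by (simp flip: complex_norm_square)
  ultimately have "norm (1 - a * cnj a) = 1 - (norm a)\<^sup>2"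
    by (simp only: norm_of_real)
  moreover have "M 0 = a"
    by (simp add: M_def Moebius_function_of_zero)
  ultimately have "pi / 4 * norm (Q 0) = c"
    by (simp add: Q_def b_def c_def norm_mult norm_power)
  moreover have "\<bar>Re (\<zeta> ^ p * Q \<zeta>)\<bar> < 1" if "\<zeta> \<in> unit_disc" for \<zeta>
    using strip[OF M[OF that]] fM[OF that] by simp
  ultimately have "\<bar>Re (\<zeta> ^ p * Q \<zeta>)\<bar>
      \<le> 4 / pi * arctan (norm \<zeta> ^ p * ((norm \<zeta> + c) / (1 + c * norm \<zeta>)))"
    using Schwarz_strip_zero[OF \<open>p \<ge> 1\<close> Q _ \<zeta>] by simp
  then show ?thesis
    unfolding fM[OF \<zeta>] M_def by linarith
qed

section \<open>Radial limits and slopes at the boundary\<close>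

text \<open>
  The point \<open>\<xi>\<close> is the preimage of \<open>\<alpha>\<close> under the disc automorphism that sends \<open>0\<close> to \<open>a\<close>. The image
  of the radius to \<open>\<xi>\<close> meets the circle at \<open>\<alpha>\<close> orthogonally, because automorphisms are conformal
  up to the circle; therefore its velocity there is a positive multiple of \<open>\<alpha>\<close>. The
  computations rest on \<open>1 - cnj a * \<alpha> = \<alpha> * cnj (\<alpha> - a)\<close>, valid for \<open>\<bar>\<alpha>\<bar> = 1\<close>.
\<close>

lemma moebius_radial_path:
  assumes "norm a < 1" "norm \<alpha> = 1"
  defines "\<xi> \<equiv> (\<alpha> - a) / (1 - cnj a * \<alpha>)"
  shows "norm \<xi> = 1" "Moebius_function 0 (-a) \<xi> = \<alpha>"
    and "((\<lambda>r. Moebius_function 0 (-a) (of_real r * \<xi>)) has_vector_derivative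
            \<alpha> * of_real ((norm (1 - cnj a * \<alpha>))\<^sup>2 / (1 - (norm a)\<^sup>2))) (at 1 within T)"
proof -
  define s where "s = 1 - cnj a * \<alpha>"
  define d where "d = 1 - a * cnj a"
  have \<alpha>: "\<alpha> * cnj \<alpha> = 1"
    using assms(2) by (simp flip: complex_norm_square)
  have s: "s = \<alpha> * cnj (\<alpha> - a)"
    using \<alpha> by (simp add: s_def algebra_simps)
  have d: "d = of_real (1 - (norm a)\<^sup>2)"
    unfolding d_def by (simp flip: complex_norm_square)
  have "(norm a)\<^sup>2 < 1"
    using assms(1) by (simp add: power_less_one_iff abs_square_less_1)
  then have d0: "d \<noteq> 0"
    unfolding d by (simp only: of_real_eq_0_iff)
  have "\<alpha> \<noteq> a"
    using assms(1,2) by auto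
  have s0: "s \<noteq> 0"
    using \<open>\<alpha> \<noteq> a\<close> assms(2) unfolding s by auto
  have \<xi>: "\<xi> * s = \<alpha> - a"
    using s0 by (simp add: \<xi>_def s_def)
  have "norm s = norm (\<alpha> - a)"
    unfolding s norm_mult complex_mod_cnj using assms(2) by simp
  then show "norm \<xi> = 1"
    using \<open>\<alpha> \<noteq> a\<close> unfolding \<xi>_def s_def[symmetric] norm_divide by simp
  have den: "(1 + cnj a * \<xi>) * s = d"
    unfolding distrib_right mult.assoc \<xi> by (simp add: s_def d_def algebra_simps)
  then have den0: "1 + cnj a * \<xi> \<noteq> 0"
    using d0 by auto
  have "(\<xi> + a) * s = \<alpha> * d"
    unfolding distrib_right \<xi> by (simp add: s_def d_def algebra_simps)
  then have "(\<xi> + a) * s = \<alpha> * (1 + cnj a * \<xi>) * s"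
    by (simp add: den mult.assoc)
  then have num: "\<xi> + a = \<alpha> * (1 + cnj a * \<xi>)"
    using s0 by simp
  then show "Moebius_function 0 (-a) \<xi> = \<alpha>"
    using den0 by (simp add: Moebius_function_simple)
  have N: "of_real ((norm s)\<^sup>2) = (\<alpha> - a) * cnj (\<alpha> - a)"
    unfolding \<open>norm s = _\<close> by (rule complex_norm_square)
  have "(\<alpha> - a) * s = \<alpha> * of_real ((norm s)\<^sup>2)"
    unfolding N by (subst s) (simp only: mult_ac)
  have "\<xi> * d / (1 + cnj a * \<xi>)\<^sup>2 = \<alpha> * of_real ((norm s)\<^sup>2 / (1 - (norm a)\<^sup>2))"
  proof -
    have "\<xi> * d / (1 + cnj a * \<xi>)\<^sup>2 = (\<xi> * s) * s * d / ((1 + cnj a * \<xi>) * s)\<^sup>2"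
      using s0 den0 by (simp add: power2_eq_square)
    also have "\<dots> = (\<alpha> - a) * s / d"
      unfolding den \<xi> using d0 by (simp add: power2_eq_square)
    also have "\<dots> = \<alpha> * (of_real ((norm s)\<^sup>2) / d)"
      using \<open>(\<alpha> - a) * s = _\<close> by simp
    also have "\<dots> = \<alpha> * of_real ((norm s)\<^sup>2 / (1 - (norm a)\<^sup>2))"
      unfolding d of_real_divide by (rule refl)
    finally show ?thesis .
  qed
  moreover have "((\<lambda>z. (z * \<xi> + a) / (1 + cnj a * (z * \<xi>))) has_field_derivative
      (\<xi> * (1 + cnj a * \<xi>) - (\<xi> + a) * (cnj a * \<xi>)) / ((1 + cnj a * \<xi>) * (1 + cnj a * \<xi>))) (at (of_real 1))"
    using den0 by (auto intro!: derivative_eq_intros)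
  moreover have "(\<xi> * (1 + cnj a * \<xi>) - (\<xi> + a) * (cnj a * \<xi>)) = \<xi> * d"
    by (simp add: d_def algebra_simps)
  ultimately have "((\<lambda>z. (z * \<xi> + a) / (1 + cnj a * (z * \<xi>))) has_field_derivative
      \<alpha> * of_real ((norm s)\<^sup>2 / (1 - (norm a)\<^sup>2))) (at (of_real 1))"
    by (simp only: power2_eq_square)
  from has_vector_derivative_real_field[OF this]
  show "((\<lambda>r. Moebius_function 0 (-a) (of_real r * \<xi>)) has_vector_derivative
            \<alpha> * of_real ((norm (1 - cnj a * \<alpha>))\<^sup>2 / (1 - (norm a)\<^sup>2))) (at 1 within T)"
    by (simp add: Moebius_function_simple o_def s_def)
qed

text \<open>
  The majorant has the value \<open>1\<close> at \<open>r = 1\<close> because \<open>arctan 1 = pi / 4\<close>. A function that stays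
  below it to the left of \<open>1\<close> and meets it at \<open>1\<close> must arrive with at least its slope, which is
  \<open>4 / pi * (1 / 2) * (n + (1 - c) / (1 + c))\<close>.
\<close>

lemma boundary_slope_bound:
  fixes v :: "real \<Rightarrow> real"
  assumes v: "(v has_real_derivative D) (at 1 within {0..<1})" and "v 1 = 1" and c: "c \<ge> 0"
    and le: "\<And>r. 0 \<le> r \<Longrightarrow> r < 1 \<Longrightarrow> v r \<le> 4 / pi * arctan (r ^ n * ((r + c) / (1 + c * r)))"
  shows "2 / pi * (((real n + 1) + (real n - 1) * c) / (1 + c)) \<le> D"
proof (rule ccontr)
  assume D: "\<not> ?thesis"
  define \<rho> where "\<rho> = (\<lambda>r. r ^ n * ((r + c) / (1 + c * r)))"
  define \<psi> where "\<psi> = (\<lambda>r. 4 / pi * arctan (\<rho> r))"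
  have nz: "1 + c * 1 \<noteq> 0" 
    using c by auto
  have "\<rho> 1 = 1"
    using nz by (simp add: \<rho>_def add.commute)
  have "(\<rho> has_real_derivative real n + (1 - c) / (1 + c)) (at 1 within {0..<1})"
  proof -
    have "((1 + 0) * (1 + c * 1) - (1 + c) * (0 + c * 1)) / ((1 + c * 1) * (1 + c * 1)) = (1 - c) / (1 + c)"
      using nz by (simp add: divide_simps) (simp add: algebra_simps)
    moreover have "((\<lambda>r. (r + c) / (1 + c * r)) has_real_derivative
        ((1 + 0) * (1 + c * 1) - (1 + c) * (0 + c * 1)) / ((1 + c * 1) * (1 + c * 1))) (at 1 within {0..<1})"
      by (intro DERIV_divide DERIV_add DERIV_cmult DERIV_const DERIV_ident nz)
    ultimately have "((\<lambda>r. (r + c) / (1 + c * r)) has_real_derivative (1 - c) / (1 + c)) (at 1 within {0..<1})"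
      by simp
    from DERIV_mult[OF DERIV_power[OF DERIV_ident, of n] this] show ?thesis
      unfolding \<rho>_def using nz by (simp add: add.commute)
  qed
  from DERIV_cmult[OF DERIV_chain2[OF DERIV_arctan this], of "4 / pi"]
  have "(\<psi> has_real_derivative 4 / pi * ((real n + (1 - c) / (1 + c)) / 2)) (at 1 within {0..<1})"
    unfolding \<psi>_def \<open>\<rho> 1 = 1\<close> by (simp only: one_power2 one_add_one divide_inverse mult.commute)
  also have "4 / pi * ((real n + (1 - c) / (1 + c)) / 2) = 2 / pi * (((real n + 1) + (real n - 1) * c) / (1 + c))"
    using nz by (simp add: divide_simps) (simp add: algebra_simps)
  finally have "((\<lambda>r. \<psi> r - v r) has_real_derivative
      2 / pi * (((real n + 1) + (real n - 1) * c) / (1 + c)) - D) (at 1 within {0..<1})"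
    by (intro DERIV_diff v)
  moreover have "2 / pi * (((real n + 1) + (real n - 1) * c) / (1 + c)) - D > 0"
    using D by simp
  ultimately obtain d where d: "d > 0"
    "\<And>t. t > 0 \<Longrightarrow> 1 - t \<in> {0..<1} \<Longrightarrow> t < d \<Longrightarrow> \<psi> (1 - t) - v (1 - t) < \<psi> 1 - v 1"
    using has_real_derivative_pos_inc_left[of "\<lambda>r. \<psi> r - v r"] by blast
  have "\<psi> 1 - v 1 = 0"
    using \<open>\<rho> 1 = 1\<close> assms(2) by (simp add: \<psi>_def arctan_one)
  moreover define t where "t = min 1 d / 2"
  have "t > 0" "t < d" "t < 1"
    using \<open>d > 0\<close> by (auto simp: t_def)
  moreover have "\<psi> (1 - t) - v (1 - t) \<ge> 0"
    using le[of "1 - t"] \<open>t > 0\<close> \<open>t < 1\<close> by (simp add: \<psi>_def \<rho>_def)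
  ultimately show False
    using d(2)[of t] by auto
qed

section \<open>The boundary Schwarz inequality for harmonic mappings\<close>

theorem theorem1p2:
  fixes p :: nat and a \<alpha> \<beta> wz_\<alpha> wzbar_\<alpha> :: complex
    and w h g :: "complex \<Rightarrow> complex"
  assumes "p \<ge> 1"
    and "a \<in> unit_disc"
    and "h holomorphic_on unit_disc" and "g holomorphic_on unit_disc"
    and "\<forall>z\<in>unit_disc. w z = h z + cnj (g z)"
    and "sense_preserving_harmonic w"
    and "has_zero_of_order w a p"
    and "w ` unit_disc \<subseteq> unit_disc"
    and "\<alpha> \<in> unit_circle" and "\<beta> \<in> unit_circle"
    and "w \<alpha> = \<beta>"
    and "has_boundary_derivatives w \<alpha> wz_\<alpha> wzbar_\<alpha>"
  shows "Re (cnj \<beta> * (wz_\<alpha> * \<alpha> + wzbar_\<alpha> * cnj \<alpha>)) \<ge>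
           2 / pi *
           (((real p + 1) + pi / 4 * (real p - 1) * Lambda h g p a * (1 - (norm a)\<^sup>2) ^ p) /
            (1 + pi / 4 * Lambda h g p a * (1 - (norm a)\<^sup>2) ^ p)) *
           ((1 - (norm a)\<^sup>2) / (norm (1 - cnj a * \<alpha>))\<^sup>2) \<and>
         (\<alpha> = 1 \<and> \<beta> = 1 \<and> a = 0 \<longrightarrow>
           Re (wz_\<alpha> + wzbar_\<alpha>) \<ge>
           2 / pi *
           (((real p + 1) + pi / 4 * (real p - 1) * (norm (taylor_coeff h 0 p) + norm (taylor_coeff g 0 p))) /
            (1 + pi / 4 * (norm (taylor_coeff h 0 p) + norm (taylor_coeff g 0 p)))))"
    (is "?main \<and> (_ \<longrightarrow> ?special)")
proof -
  have na: "norm a < 1" and n\<alpha>: "norm \<alpha> = 1" and n\<beta>: "norm \<beta> = 1"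
    using assms(2,9,10) by auto
  define \<delta> where "\<delta> = 1 - (norm a)\<^sup>2"
  define N where "N = (norm (1 - cnj a * \<alpha>))\<^sup>2"
  define \<kappa> where "\<kappa> = pi / 4 * Lambda h g p a * \<delta> ^ p"
  define X where "X = Re (cnj \<beta> * (wz_\<alpha> * \<alpha> + wzbar_\<alpha> * cnj \<alpha>))"
  have "\<delta> > 0"
    using na by (simp add: \<delta>_def abs_square_less_1)
  have "N > 0"
  proof -
    have "norm (cnj a * \<alpha>) \<noteq> 1"
      using na n\<alpha> by (simp add: norm_mult)
    then show ?thesis
      unfolding N_def by auto
  qed
  obtain h0 g0 where h0: "h0 holomorphic_on unit_disc" and g0: "g0 holomorphic_on unit_disc"
    and w0: "\<And>z. z \<in> unit_disc \<Longrightarrow> w z = h0 z + cnj (g0 z)"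
    and van: "\<And>k. k < p \<Longrightarrow> (deriv ^^ k) h0 a = 0" "\<And>k. k < p \<Longrightarrow> (deriv ^^ k) g0 a = 0"
    and top: "(deriv ^^ p) h0 a = (deriv ^^ p) h a" "(deriv ^^ p) g0 a = (deriv ^^ p) g a"
    using vanishing_decomposition[OF assms(1-7)] by metis
  obtain q1 where q1: "q1 holomorphic_on unit_disc"
      "\<And>z. z \<in> unit_disc \<Longrightarrow> h0 z = (z - a) ^ p * q1 z" "q1 a = taylor_coeff h0 a p"
    using higher_deriv_zero_factor[OF h0 open_ball assms(2) van(1)] by metis
  obtain q2 where q2: "q2 holomorphic_on unit_disc"
      "\<And>z. z \<in> unit_disc \<Longrightarrow> g0 z = (z - a) ^ p * q2 z" "q2 a = taylor_coeff g0 a p"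
    using higher_deriv_zero_factor[OF g0 open_ball assms(2) van(2)] by metis
  \<comment> \<open>The conjugate of the coanalytic part is traded for the part itself, with \<open>\<beta>\<close> in place
    of \<open>cnj \<beta>\<close>; the real part does not change.\<close>
  define q where "q = (\<lambda>z. cnj \<beta> * q1 z + \<beta> * q2 z)"
  define f where "f = (\<lambda>z. cnj \<beta> * h0 z + \<beta> * g0 z)"
  have q: "q holomorphic_on unit_disc"
    unfolding q_def by (intro holomorphic_intros q1 q2)
  have fq: "f z = (z - a) ^ p * q z" if "z \<in> unit_disc" for z
    using q1(2)[OF that] q2(2)[OF that] by (simp add: f_def q_def algebra_simps)
  have Ref: "Re (f z) = Re (cnj \<beta> * w z)" if "z \<in> unit_disc" for z
    using w0[OF that] by (simp add: f_def algebra_simps)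
  have strip: "\<bar>Re (f z)\<bar> < 1" if "z \<in> unit_disc" for z
  proof -
    have "\<bar>Re (cnj \<beta> * w z)\<bar> \<le> norm (cnj \<beta> * w z)"
      by (rule abs_Re_le_cmod)
    also have "\<dots> < 1"
      using assms(8) that n\<beta> by (simp add: norm_mult image_subset_iff)
    finally show ?thesis
      by (simp only: Ref[OF that])
  qed
  define c where "c = pi / 4 * (norm (q a) * \<delta> ^ p)"
  have "c \<ge> 0"
    using \<open>\<delta> > 0\<close> by (simp add: c_def)
  have "norm (q a) \<le> Lambda h g p a"
  proof -
    have "norm (q a) \<le> norm (cnj \<beta> * q1 a) + norm (\<beta> * q2 a)"
      unfolding q_def by (rule norm_triangle_ineq)
    also have "\<dots> = norm (q1 a) + norm (q2 a)"
      using n\<beta> by (simp add: norm_mult)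
    finally show ?thesis
      by (simp only: Lambda_def q1(3) q2(3) top)
  qed
  then have "c \<le> \<kappa>"
    using \<open>\<delta> > 0\<close> unfolding c_def \<kappa>_def by (simp add: mult.assoc mult_right_mono)
  define \<xi> where "\<xi> = (\<alpha> - a) / (1 - cnj a * \<alpha>)"
  define M where "M = (\<lambda>r::real. Moebius_function 0 (-a) (of_real r * \<xi>))"
  note path = moebius_radial_path[OF na n\<alpha>, folded \<xi>_def]
  have M1: "M 1 = \<alpha>"
    using path(2) by (simp add: M_def)
  have Mdisc: "of_real r * \<xi> \<in> unit_disc" "M r \<in> unit_disc" if "0 \<le> r" "r < 1" for r
  proof -
    show "of_real r * \<xi> \<in> unit_disc"
      using that path(1) by (simp add: norm_mult)
    then show "M r \<in> unit_disc"
      using Moebius_function_norm_lt_1[of "-a" "of_real r * \<xi>"] na by (simp add: M_def)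
  qed
  define v where "v = (\<lambda>r. Re (cnj \<beta> * w (M r)))"
  have "cnj \<beta> * \<beta> = 1"
    using n\<beta> complex_norm_square[of \<beta>] by (simp add: mult.commute)
  then have "v 1 = 1"
    by (simp only: v_def M1 assms(11) one_complex.sel)
  have le: "v r \<le> 4 / pi * arctan (r ^ p * ((r + c) / (1 + c * r)))" if "0 \<le> r" "r < 1" for r
    using Schwarz_strip_Moebius[OF assms(1,2) q fq strip Mdisc(1)[OF that]] path(1) that
      Ref[OF Mdisc(2)[OF that]]
    by (simp add: v_def M_def c_def \<delta>_def norm_mult)
  have "(v has_real_derivative N / \<delta> * X) (at 1 within {0..<1})"
  proof -
    \<comment> \<open>The derivative at \<open>\<alpha>\<close> is taken within the open disc, which the path stays in before
      it reaches its end point.\<close>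
    have wD: "(w has_derivative (\<lambda>v. wz_\<alpha> * v + wzbar_\<alpha> * cnj v)) (at (M 1) within M ` {0..<1})"
      using assms(12) unfolding has_boundary_derivatives_def M1
      by (rule has_derivative_subset) (use Mdisc(2) in auto)
    have MD: "(M has_derivative (\<lambda>t. t *\<^sub>R (\<alpha> * of_real (N / \<delta>)))) (at 1 within {0..<1})"
      using path(3) unfolding M_def N_def \<delta>_def has_vector_derivative_def .
    have "(v has_derivative (\<lambda>t. Re (cnj \<beta> * (wz_\<alpha> * (t *\<^sub>R (\<alpha> * of_real (N / \<delta>)))
        + wzbar_\<alpha> * cnj (t *\<^sub>R (\<alpha> * of_real (N / \<delta>))))))) (at 1 within {0..<1})"
      unfolding v_def
      by (intro has_derivative_Re has_derivative_mult_right has_derivative_in_compose[OF MD wD])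
    also have "(\<lambda>t. Re (cnj \<beta> * (wz_\<alpha> * (t *\<^sub>R (\<alpha> * of_real (N / \<delta>)))
        + wzbar_\<alpha> * cnj (t *\<^sub>R (\<alpha> * of_real (N / \<delta>)))))) = (*) (N / \<delta> * X)"
    proof
      fix t :: real
      have "cnj \<beta> * (wz_\<alpha> * (t *\<^sub>R (\<alpha> * of_real (N / \<delta>)))
          + wzbar_\<alpha> * cnj (t *\<^sub>R (\<alpha> * of_real (N / \<delta>))))
        = of_real (t * (N / \<delta>)) * (cnj \<beta> * (wz_\<alpha> * \<alpha> + wzbar_\<alpha> * cnj \<alpha>))"
        by (simp add: scaleR_conv_of_real algebra_simps)
      moreover have "Re (of_real r * x) = r * Re x" for r and x :: complex
        by simp
      ultimately have "Re (cnj \<beta> * (wz_\<alpha> * (t *\<^sub>R (\<alpha> * of_real (N / \<delta>)))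
          + wzbar_\<alpha> * cnj (t *\<^sub>R (\<alpha> * of_real (N / \<delta>))))) = t * (N / \<delta>) * X"
        unfolding X_def by (simp only:)
      then show "Re (cnj \<beta> * (wz_\<alpha> * (t *\<^sub>R (\<alpha> * of_real (N / \<delta>)))
          + wzbar_\<alpha> * cnj (t *\<^sub>R (\<alpha> * of_real (N / \<delta>))))) = N / \<delta> * X * t"
        by (simp only: mult_ac)
    qed
    finally show ?thesis
      by (simp only: has_field_derivative_def)
  qed
  from boundary_slope_bound[OF this \<open>v 1 = 1\<close> \<open>c \<ge> 0\<close> le]
  have slope: "2 / pi * (((real p + 1) + (real p - 1) * c) / (1 + c)) \<le> N / \<delta> * X" .
  \<comment> \<open>In this form the slope is visibly decreasing in \<open>x\<close>.\<close>
  have eq: "((real p + 1) + (real p - 1) * x) / (1 + x) = (real p - 1) + 2 / (1 + x)" if "x \<ge> 0" for x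
    using that by (simp add: divide_simps) (simp add: algebra_simps)
  have "((real p + 1) + (real p - 1) * \<kappa>) / (1 + \<kappa>) \<le> ((real p + 1) + (real p - 1) * c) / (1 + c)"
    using \<open>c \<ge> 0\<close> \<open>c \<le> \<kappa>\<close> by (subst (1 2) eq) (auto intro!: divide_left_mono)
  then have "2 / pi * (((real p + 1) + (real p - 1) * \<kappa>) / (1 + \<kappa>)) \<le> N / \<delta> * X"
    by (intro order_trans[OF mult_left_mono slope]) auto
  then have "2 / pi * (((real p + 1) + (real p - 1) * \<kappa>) / (1 + \<kappa>)) * (\<delta> / N) \<le> N / \<delta> * X * (\<delta> / N)"
    using \<open>\<delta> > 0\<close> \<open>N > 0\<close> by (intro mult_right_mono) auto
  also have "N / \<delta> * X * (\<delta> / N) = X"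
    using \<open>\<delta> > 0\<close> \<open>N > 0\<close> by simp
  finally have main: ?main
    unfolding \<kappa>_def X_def N_def \<delta>_def by (simp only: mult_ac)
  moreover have ?special if "\<alpha> = 1 \<and> \<beta> = 1 \<and> a = 0"
    using main that by (simp add: Lambda_def)
  ultimately show ?thesis
    by blast
qed

end
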